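(* Let $N=(P,T,\mathrm{Pre},\mathrm{Post},m_0)$ be a marked Petri net and let $A\subseteq P$ be a set of places that can be chain agglomerated (then $A=\{p,q\}$) or loop agglomerated (then $A=\{\pi_0,\dots,\pi_{n-1}\}$). Let $N'$ be the net obtained from $N$ by replacing the places of $A$ by a single new place $a$ equal to their sum $a=\boxplus_{r\in A}r$. Then for all markings $m:P\setminus A\to\mathbb{N}$ and $m':A\to\mathbb{N}$, $$(m\cup m')\in\mathcal{R}(N)\iff m\cup\{(a,\textstyle\sum_{r\in A}m'(r))\}\in\mathcal{R}(N').$$
   Context: A marked Petri net is a tuple $N=(P,T,\mathrm{Pre},\mathrm{Post},m_0)$ with $P,T$ disjoint finite sets, $\mathrm{Pre},\mathrm{Post}:T\to(P\to\mathbb{N})$, and $m_0:P\to\mathbb{N}$. A marking is a map from places to $\mathbb{N}$, written as a set of pairs (place, value); a transition $t$ is enabled at $m$ if $m\ge\mathrm{Pre}(t)$ pointwise, and firing it yields $m-\mathrm{Pre}(t)+\mathrm{Post}(t)$. $\mathcal{R}(N)$ is the set of markings reachable from $m_0$. For a transition $t$: ${}^\bullet t=\{p\mid \mathrm{Pre}(t)(p)>0\}$, $t^\bullet=\{p\mid\mathrm{Post}(t)(p)>0\}$; for a place $p$: ${}^\bullet p=\{t\mid\mathrm{Post}(t)(p)>0\}$. A place $a$ is the sum of places $p_1,\dots,p_k$, written $a=p_1\boxplus\cdots\boxplus p_k$, if $m_0(a)=\sum_i m_0(p_i)$ and for every transition $t$, $\mathrm{Pre}(t)(a)=\sum_i\mathrm{Pre}(t)(p_i)$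 and $\mathrm{Post}(t)(a)=\sum_i\mathrm{Post}(t)(p_i)$; replacing the places of $A$ by $a$ means the new net has places $(P\setminus A)\cup\{a\}$, the same transitions, the same pre/post conditions and initial marking on $P\setminus A$, and $a$ defined as that sum. Places $p,q$ can be chain agglomerated if there is $t\in T$ with ${}^\bullet t=\{p\}$, $t^\bullet=\{q\}$, $\mathrm{Pre}(t)(p)=\mathrm{Post}(t)(q)=1$, ${}^\bullet q=\{t\}$ and $m_0(q)=0$. A sequence of $n$ distinct places $\pi_0,\dots,\pi_{n-1}$ can be loop agglomerated if for every $i<n$ there is $t\in T$ such that $\mathrm{Pre}(t)$ is the function equal to $1$ on $\pi_i$ and $0$ elsewhere, and $\mathrm{Post}(t)$ is the function equal to $1$ on $\pi_{(i+1)\bmod n}$ and $0$ elsewhere. *)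

theory Defs
  imports Main "HOL-Library.FuncSet"
begin

(* Places and transitions have different types, so they are disjoint by construction.
   A map from a set X to a set Y is an element of X \<rightarrow>\<^sub>E Y, so that two such maps
   are equal iff they agree on X. *)

record ('p, 't) net =
  places :: "'p set"
  transitions :: "'t set"
  pre :: "'t \<Rightarrow> 'p \<Rightarrow> nat"
  post :: "'t \<Rightarrow> 'p \<Rightarrow> nat"
  init :: "'p \<Rightarrow> nat"

definition markings :: "'p set \<Rightarrow> ('p \<Rightarrow> nat) set" where
  "markings X = X \<rightarrow>\<^sub>E UNIV"

definition petri_net :: "('p, 't) net \<Rightarrow> bool" where
  "petri_net N \<longleftrightarrow>
     finite (places N) \<and> finite (transitions N) \<and>
     pre N \<in> transitions N \<rightarrow>\<^sub>E markings (places N) \<and>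
     post N \<in> transitions N \<rightarrow>\<^sub>E markings (places N) \<and>
     init N \<in> markings (places N)"

definition enabled :: "('p, 't) net \<Rightarrow> 't \<Rightarrow> ('p \<Rightarrow> nat) \<Rightarrow> bool" where
  "enabled N t m \<longleftrightarrow> (\<forall>p\<in>places N. pre N t p \<le> m p)"

definition fire :: "('p, 't) net \<Rightarrow> 't \<Rightarrow> ('p \<Rightarrow> nat) \<Rightarrow> 'p \<Rightarrow> nat" where
  "fire N t m = (\<lambda>p\<in>places N. m p - pre N t p + post N t p)"

inductive_set reachable :: "('p, 't) net \<Rightarrow> ('p \<Rightarrow> nat) set" for N where
  init: "init N \<in> reachable N"
| step: "m \<in> reachable N \<Longrightarrow> t \<in> transitions N \<Longrightarrow> enabled N t m \<Longrightarrow> fire N t m \<in> reachable N"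

definition input_places :: "('p, 't) net \<Rightarrow> 't \<Rightarrow> 'p set" where
  "input_places N t = {p \<in> places N. pre N t p > 0}"

definition output_places :: "('p, 't) net \<Rightarrow> 't \<Rightarrow> 'p set" where
  "output_places N t = {p \<in> places N. post N t p > 0}"

definition input_transitions :: "('p, 't) net \<Rightarrow> 'p \<Rightarrow> 't set" where
  "input_transitions N p = {t \<in> transitions N. post N t p > 0}"

definition chain_agglomerable :: "('p, 't) net \<Rightarrow> 'p \<Rightarrow> 'p \<Rightarrow> bool" where
  "chain_agglomerable N p q \<longleftrightarrow>
     p \<in> places N \<and> q \<in> places N \<and>
     (\<exists>t\<in>transitions N.
        input_places N t = {p} \<and> output_places N t = {q} \<and>
        pre N t p = 1 \<and> post N t q = 1 \<and>
        input_transitions N q = {t} \<and> init N q = 0)"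

definition loop_agglomerable :: "('p, 't) net \<Rightarrow> 'p list \<Rightarrow> bool" where
  "loop_agglomerable N \<pi> \<longleftrightarrow>
     distinct \<pi> \<and> set \<pi> \<subseteq> places N \<and>
     (\<forall>i<length \<pi>. \<exists>t\<in>transitions N.
        pre N t = (\<lambda>p\<in>places N. if p = \<pi> ! i then 1 else 0) \<and>
        post N t = (\<lambda>p\<in>places N. if p = \<pi> ! (Suc i mod length \<pi>) then 1 else 0))"

definition replace_by_sum :: "('p, 't) net \<Rightarrow> 'p set \<Rightarrow> 'p \<Rightarrow> ('p, 't) net" where
  "replace_by_sum N A a =
     \<lparr>places = insert a (places N - A),
      transitions = transitions N,
      pre = (\<lambda>t\<in>transitions N. (restrict (pre N t) (places N - A))(a := \<Sum>r\<in>A. pre N t r)),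
      post = (\<lambda>t\<in>transitions N. (restrict (post N t) (places N - A))(a := \<Sum>r\<in>A. post N t r)),
      init = (restrict (init N) (places N - A))(a := \<Sum>r\<in>A. init N r)\<rparr>"

lemma petri_net_replace_by_sum:
  "petri_net N \<Longrightarrow> petri_net (replace_by_sum N A a)"
  by (auto simp: petri_net_def replace_by_sum_def markings_def PiE_def extensional_def)

end

theory Submission
  imports Defs
begin

text \<open>
  Summing the places of \<open>A\<close> commutes with firing, so runs of the net project to runs of the
  agglomerated net. Conversely, a run of the agglomerated net is lifted one transition at a time,
  maintaining that \<^emph>\<open>every\<close> distribution of the tokens of \<open>a\<close> over \<open>A\<close> is reachable: redistribute
  the tokens so that the transition becomes enabled, fire it, and redistribute again. In a loop,
  tokens can be carried from any place to any other. In a chain they can only be carried from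
  \<open>p\<close> to \<open>q\<close>; but \<open>q\<close> is filled only by the chain transition, so one can put in \<open>q\<close> exactly the
  tokens that are about to be consumed, after which \<open>q\<close> is empty and all distributions are
  available again.
\<close>

section \<open>Merged markings and moves of a single token\<close>

definition merge :: "'p set \<Rightarrow> 'p set \<Rightarrow> 'p \<Rightarrow> ('p \<Rightarrow> nat) \<Rightarrow> 'p \<Rightarrow> nat" where
  "merge P A a M = (restrict M (P - A))(a := \<Sum>r\<in>A. M r)"

text \<open>The two updates are made in sequence, so that \<open>x = y\<close> gives back
  \<open>M\<close> when \<open>x\<close> is marked. This case arises from a loop with one
  place.\<close>

definition move :: "'p \<Rightarrow> 'p \<Rightarrow> ('p \<Rightarrow> nat) \<Rightarrow> 'p \<Rightarrow> nat" where
  "move x y M = (let M1 = M(x := M x - 1) in M1(y := M1 y + 1))"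

definition carries :: "('p, 't) net \<Rightarrow> 't \<Rightarrow> 'p \<Rightarrow> 'p \<Rightarrow> bool" where
  "carries N t x y \<longleftrightarrow>
     (\<forall>r\<in>places N. pre N t r = (if r = x then 1 else 0) \<and>
                   post N t r = (if r = y then 1 else 0))"

lemma move_same [simp]: "M x > 0 \<Longrightarrow> move x x M = M"
  by (auto simp: move_def)

lemma move_move: "M x > 0 \<Longrightarrow> move y z (move x y M) = move x z M"
  by (auto simp: move_def Let_def fun_eq_iff)

lemma move_target_pos: "move x y M y > 0"
  by (auto simp: move_def Let_def)

lemma move_apply:
  "x \<noteq> y \<Longrightarrow> move x y M r = (if r = x then M x - 1 else if r = y then M y + 1 else M r)"
  by (auto simp: move_def)

lemma sum_move:
  assumes "finite A" "x \<in> A" "y \<in> A" "M x > 0"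
  shows "sum (move x y M) A = sum M A"
proof (cases "x = y")
  case False
  have "sum f A = f x + f y + sum f (A - {x} - {y})" for f :: "'a \<Rightarrow> nat"
    using assms False by (simp add: sum.remove[of A x] sum.remove[of "A - {x}" y])
  moreover have "sum (move x y M) (A - {x} - {y}) = sum M (A - {x} - {y})"
    using False by (intro sum.cong) (auto simp: move_apply)
  ultimately show ?thesis
    using False assms by (simp add: move_apply)
qed (use assms in simp)

text \<open>The whole surplus of \<open>f\<close> over \<open>b\<close> can be put on one element of
  \<open>A\<close>.\<close>

lemma sum_redistribute_ge:
  fixes f b :: "'a \<Rightarrow> nat"
  assumes "finite A" "sum b A \<le> sum f A"
  obtains d where "\<And>r. b r \<le> d r" "sum d A = sum f A"
proof (cases "A = {}")
  case False
  then obtain x where x: "x \<in> A" by blast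
  let ?d = "b(x := b x + (sum f A - sum b A))"
  have "sum ?d (A - {x}) = sum b (A - {x})"
    by (intro sum.cong) auto
  then have "sum ?d A = sum f A"
    using assms x by (simp add: sum.remove[of A x])
  then show thesis
    by (intro that[of ?d]) auto
qed (use that in auto)

lemma eq_if_le_sum_eq:
  fixes f g :: "'a \<Rightarrow> nat"
  assumes "finite A" "\<And>r. r \<in> A \<Longrightarrow> f r \<le> g r" "sum f A = sum g A" "x \<in> A"
  shows "f x = g x"
  using sum_strict_mono_ex1[of A f g] assms by (metis le_neq_implies_less less_irrefl)

section \<open>Projecting runs of the net to the agglomerated net\<close>

locale agglomeration =
  fixes N :: "('p, 't) net" and A :: "'p set" and a :: 'p
  assumes net: "petri_net N" and A_places: "A \<subseteq> places N" and a_fresh: "a \<notin> places N"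
begin

abbreviation "P \<equiv> places N"
abbreviation "N' \<equiv> replace_by_sum N A a"
abbreviation "mrg \<equiv> merge P A a"

lemma finite_A: "finite A"
  using net A_places finite_subset by (auto simp: petri_net_def)

lemma reachable_markings: "M \<in> reachable N \<Longrightarrow> M \<in> markings P"
  by (induction rule: reachable.induct)
    (use net in \<open>auto simp: petri_net_def fire_def markings_def\<close>)

lemma init_replace: "init N' = mrg (init N)"
  by (simp add: replace_by_sum_def merge_def)

lemma enabled_replace_iff:
  assumes "t \<in> transitions N"
  shows "enabled N' t (mrg M) \<longleftrightarrow>
    (\<forall>r\<in>P - A. pre N t r \<le> M r) \<and> sum (pre N t) A \<le> sum M A"
  using assms a_fresh by (auto simp: enabled_def replace_by_sum_def merge_def)

lemma enabled_merge:
  assumes "t \<in> transitions N" "enabled N t M"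
  shows "enabled N' t (mrg M)"
  unfolding enabled_replace_iff[OF assms(1)]
  using assms A_places by (auto simp: enabled_def intro!: sum_mono)

text \<open>Subtraction is truncated, so it commutes with the sum over \<open>A\<close> only because
  each place of \<open>A\<close> holds enough tokens for \<open>t\<close>.\<close>

lemma fire_merge:
  assumes "t \<in> transitions N" "enabled N t M"
  shows "fire N' t (mrg M) = mrg (fire N t M)"
proof -
  have le: "pre N t r \<le> M r" if "r \<in> A" for r
    using assms A_places that by (auto simp: enabled_def)
  have "(\<Sum>r\<in>A. fire N t M r) = (\<Sum>r\<in>A. M r - pre N t r + post N t r)"
    using A_places by (intro sum.cong) (auto simp: fire_def)
  also have "\<dots> = sum M A - sum (pre N t) A + sum (post N t) A"
    using le by (simp only: sum.distrib sum_subtractf_nat)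
  finally show ?thesis
    using assms a_fresh
    by (auto simp: fire_def fun_eq_iff replace_by_sum_def merge_def)
qed

lemma merge_reachable: "M \<in> reachable N \<Longrightarrow> mrg M \<in> reachable N'"
proof (induction rule: reachable.induct)
  case init
  then show ?case
    using reachable.init[of N'] by (simp add: init_replace)
next
  case (step M t)
  then show ?case
    using reachable.step[of "mrg M" N' t] enabled_merge fire_merge
    by (simp add: replace_by_sum_def)
qed

lemma merge_eq_iff:
  "mrg M = mrg M' \<longleftrightarrow> (\<forall>r\<in>P - A. M r = M' r) \<and> sum M A = sum M' A"
proof
  assume eq: "mrg M = mrg M'"
  have "M r = M' r" if "r \<in> P - A" for r
    using fun_cong[OF eq, of r] that a_fresh by (auto simp: merge_def split: if_splits)
  moreover have "sum M A = sum M' A"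
    using fun_cong[OF eq, of a] by (simp add: merge_def)
  ultimately show "(\<forall>r\<in>P - A. M r = M' r) \<and> sum M A = sum M' A" by blast
qed (auto simp: merge_def fun_eq_iff)

lemma merge_move: "\<lbrakk>x \<in> A; y \<in> A; M x > 0\<rbrakk> \<Longrightarrow> mrg (move x y M) = mrg M"
  using sum_move[OF finite_A, of x y M] by (auto simp: merge_eq_iff move_def Let_def)

lemma merge_override:
  "sum d A = sum M A \<Longrightarrow> mrg (override_on M d A) = mrg M"
  by (auto simp: merge_eq_iff override_on_def)

lemma override_markings: "M \<in> markings P \<Longrightarrow> override_on M d A \<in> markings P"
  using A_places by (auto simp: markings_def override_on_def PiE_def extensional_def)

section \<open>Redistributing tokens inside \<open>A\<close>\<close>

lemma fire_carries:
  assumes "carries N t x y" "M \<in> markings P" "M x > 0" "x \<in> P" "y \<in> P"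
  shows "fire N t M = move x y M"
  using assms
  by (auto simp: fire_def carries_def move_def Let_def fun_eq_iff markings_def
      PiE_def extensional_def)

lemma move_reachable:
  assumes "t \<in> transitions N" "carries N t x y" "x \<in> P" "y \<in> P" "M \<in> reachable N" "M x > 0"
  shows "move x y M \<in> reachable N"
proof -
  have "enabled N t M"
    using assms by (auto simp: enabled_def carries_def)
  then show ?thesis
    using reachable.step[of M N t] fire_carries[OF assms(2) reachable_markings] assms by simp
qed

text \<open>\<open>X\<close> holds the places that can give tokens and \<open>Y\<close> those that
  can receive them; the last two premises say that no other place of \<open>A\<close> has to. Moving
  a token from a place with too many to a place with too few lowers the total excess of
  \<open>M\<close> over \<open>M'\<close>, the measure of the induction.\<close>

lemma redistribution_reachable:
  assumes closed: "\<And>M x y. \<lbrakk>M \<in> reachable N; x \<in> X; y \<in> Y; M x > 0\<rbrakk> \<Longrightarrow> move x y M \<in> reachable N"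
    and "M \<in> reachable N" "M' \<in> markings P" "mrg M = mrg M'"
    and "\<And>r. r \<in> A - X \<Longrightarrow> M r \<le> M' r" "\<And>r. r \<in> A - Y \<Longrightarrow> M' r \<le> M r"
  shows "M' \<in> reachable N"
  using assms(2-)
proof (induction "\<Sum>r\<in>A. M r - M' r" arbitrary: M rule: less_induct)
  case less
  have sum_eq: "sum M A = sum M' A"
    using less.prems by (simp add: merge_eq_iff)
  show ?case
  proof (cases "\<exists>x\<in>A. M x > M' x")
    case False
    then have "M r = M' r" if "r \<in> A" for r
      using eq_if_le_sum_eq[OF finite_A _ sum_eq that] by (meson not_le)
    \<comment> \<open>Off \<open>P\<close> both markings take the value
      \<open>undefined\<close>.\<close>
    then have "M = M'"
      using less.prems(3) less.prems(2) reachable_markings[OF less.prems(1)]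
      by (intro ext) (metis DiffI PiE_arb markings_def merge_eq_iff)
    then show ?thesis using less.prems by simp
  next
    case True
    then obtain x where x: "x \<in> A" "M x > M' x" by blast
    \<comment> \<open>The sums over \<open>A\<close> agree, so the surplus at \<open>x\<close>
      forces a deficit somewhere else.\<close>
    obtain y where y: "y \<in> A" "M y < M' y"
      using eq_if_le_sum_eq[OF finite_A _ sum_eq[symmetric] x(1)] x(2)
      by (metis less_irrefl not_le)
    have xy: "x \<noteq> y" "x \<in> X" "y \<in> Y"
      using x y less.prems(4,5) by (auto simp: not_le[symmetric])
    let ?L = "move x y M"
    have "(\<Sum>r\<in>A. ?L r - M' r) < (\<Sum>r\<in>A. M r - M' r)"
      using x y xy finite_A by (intro sum_strict_mono_ex1) (auto simp: move_apply intro!: bexI[of _ x])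
    moreover have "?L \<in> reachable N"
      using closed less.prems(1) xy x by simp
    moreover have "mrg ?L = mrg M'"
      using less.prems(3) x y by (simp add: merge_move)
    moreover have "?L r \<le> M' r" if "r \<in> A - X" for r
      using less.prems(4) that xy y by (auto simp: move_apply)
    moreover have "M' r \<le> ?L r" if "r \<in> A - Y" for r
      using less.prems(5) that xy x by (auto simp: move_apply)
    ultimately show ?thesis
      using less.hyps less.prems(2) by blast
  qed
qed

section \<open>Lifting runs of the agglomerated net\<close>

lemma enabled_redistribution:
  assumes "t \<in> transitions N" "M \<in> markings P" "enabled N' t (mrg M)"
  obtains M0 where "M0 \<in> markings P" "mrg M0 = mrg M" "enabled N t M0"
proof -
  obtain d where d: "\<And>r. pre N t r \<le> d r" "sum d A = sum M A"
    using sum_redistribute_ge[OF finite_A, of "pre N t" M] assms enabled_replace_iff by metis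
  have "enabled N t (override_on M d A)"
    using assms(3) d unfolding enabled_replace_iff[OF assms(1)]
    by (auto simp: enabled_def override_on_def)
  then show thesis
    using that override_markings merge_override d assms by blast
qed

text \<open>The induction scheme shared by loops and chains. In \<open>step\<close> each of them
  chooses the distribution \<open>M0\<close> from which \<open>t\<close> is fired; a chain cannot
  take just any enabling one.\<close>

lemma reachable_of_merge_reachable:
  assumes init: "\<And>M. M \<in> markings P \<Longrightarrow> mrg M = mrg (init N) \<Longrightarrow> M \<in> reachable N"
    and step: "\<And>t M. \<lbrakk>t \<in> transitions N; M \<in> markings P; enabled N' t (mrg M);
        \<And>M'. M' \<in> markings P \<Longrightarrow> mrg M' = mrg M \<Longrightarrow> M' \<in> reachable N\<rbrakk> \<Longrightarrow>
        \<exists>M0\<in>markings P. mrg M0 = mrg M \<and> enabled N t M0 \<and>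
          (\<forall>M'\<in>markings P. mrg M' = mrg (fire N t M0) \<longrightarrow> M' \<in> reachable N)"
    and "M \<in> markings P" "mrg M \<in> reachable N'"
  shows "M \<in> reachable N"
proof -
  \<comment> \<open>The first conjunct writes \<open>L\<close> as some \<open>mrg M\<close>, the
    form in which the premise \<open>step\<close> needs it.\<close>
  have "(\<exists>M\<in>markings P. mrg M = L) \<and> (\<forall>M\<in>markings P. mrg M = L \<longrightarrow> M \<in> reachable N)"
    if "L \<in> reachable N'" for L
    using that
  proof (induction rule: reachable.induct)
    case init
    show ?case
      using assms(1) reachable_markings[OF reachable.init] init_replace by metis
  next
    case (step L t)
    then obtain M where M: "M \<in> markings P" "L = mrg M" by blast
    have t: "t \<in> transitions N"
      using step by (simp add: replace_by_sum_def)
    then obtain M0 where M0: "M0 \<in> markings P" "mrg M0 = mrg M" "enabled N t M0"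
      "\<forall>M'\<in>markings P. mrg M' = mrg (fire N t M0) \<longrightarrow> M' \<in> reachable N"
      using assms(2)[of t M] M step by blast
    have "fire N' t L = mrg (fire N t M0)"
      using fire_merge[OF t M0(3)] M M0 by simp
    moreover have "fire N t M0 \<in> markings P"
      by (simp add: fire_def markings_def)
    ultimately show ?case
      using M0(4) by metis
  qed
  then show ?thesis using assms by blast
qed

section \<open>Loops\<close>

lemma loop_move_reachable:
  assumes loop: "loop_agglomerable N \<pi>" "A = set \<pi>"
    and "M \<in> reachable N" "x \<in> A" "y \<in> A" "M x > 0"
  shows "move x y M \<in> reachable N"
proof -
  let ?n = "length \<pi>"
  obtain i j where i: "i < ?n" "x = \<pi> ! i" and j: "j < ?n" "y = \<pi> ! j"
    using assms by (metis in_set_conv_nth)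
  have n: "?n > 0" using i by linarith
  \<comment> \<open>One token is carried \<open>k\<close> steps around the loop: the place it has
    just reached is marked, so the next loop transition can fire, and \<open>move_move\<close>
    composes the moves.\<close>
  have "move x (\<pi> ! ((i + k) mod ?n)) M \<in> reachable N" for k
  proof (induction k)
    case 0
    then show ?case using i assms by simp
  next
    case (Suc k)
    let ?l = "(i + k) mod ?n"
    have l: "?l < ?n" using n by simp
    then obtain t where t: "t \<in> transitions N" "carries N t (\<pi> ! ?l) (\<pi> ! (Suc ?l mod ?n))"
      using loop unfolding loop_agglomerable_def carries_def by fastforce
    have "\<pi> ! ?l \<in> P" "\<pi> ! (Suc ?l mod ?n) \<in> P"
      using loop l n A_places by auto
    from move_reachable[OF t this Suc move_target_pos]
    have "move x (\<pi> ! (Suc ?l mod ?n)) M \<in> reachable N"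
      using move_move assms by metis
    then show ?case by (simp add: mod_Suc_eq)
  qed
  \<comment> \<open>Adding \<open>?n\<close> makes the number of steps right also when
    \<open>j < i\<close>.\<close>
  from this[of "?n - i + j"] show ?thesis
    using i j by simp
qed

lemma loop_reachable:
  assumes loop: "loop_agglomerable N \<pi>" "A = set \<pi>"
    and M: "M \<in> markings P" "mrg M \<in> reachable N'"
  shows "M \<in> reachable N"
proof -
  have redistribute: "M' \<in> reachable N"
    if "M \<in> reachable N" "M' \<in> markings P" "mrg M = mrg M'" for M M'
    using redistribution_reachable[of A A M M'] loop_move_reachable[OF loop] that by blast
  show ?thesis
  proof (rule reachable_of_merge_reachable[OF _ _ M])
    show "M \<in> reachable N" if "M \<in> markings P" "mrg M = mrg (init N)" for M
      using redistribute[OF reachable.init] that by simp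
  next
    fix t M
    assume t: "t \<in> transitions N" and M: "M \<in> markings P" "enabled N' t (mrg M)"
      and IH: "\<And>M'. M' \<in> markings P \<Longrightarrow> mrg M' = mrg M \<Longrightarrow> M' \<in> reachable N"
    obtain M0 where M0: "M0 \<in> markings P" "mrg M0 = mrg M" "enabled N t M0"
      using enabled_redistribution t M by blast
    have "fire N t M0 \<in> reachable N"
      by (rule reachable.step[OF IH[OF M0(1,2)] t M0(3)])
    then show "\<exists>M0\<in>markings P. mrg M0 = mrg M \<and> enabled N t M0 \<and>
          (\<forall>M'\<in>markings P. mrg M' = mrg (fire N t M0) \<longrightarrow> M' \<in> reachable N)"
      using M0 redistribute by metis
  qed
qed

section \<open>Chains\<close>

lemma chain_reachable:
  assumes chain: "chain_agglomerable N p q" "A = {p, q}"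
    and M: "M \<in> markings P" "mrg M \<in> reachable N'"
  shows "M \<in> reachable N"
proof -
  obtain c where c: "c \<in> transitions N" "input_places N c = {p}" "output_places N c = {q}"
    "pre N c p = 1" "post N c q = 1" "input_transitions N q = {c}" "init N q = 0"
    and pq: "p \<in> P" "q \<in> P"
    using chain unfolding chain_agglomerable_def by blast
  have carries: "carries N c p q"
    using c by (auto simp: carries_def input_places_def output_places_def)
  \<comment> \<open>While \<open>q\<close> is empty, \<open>p\<close> holds all tokens of
    \<open>A\<close>, so any target distribution is reached by moves from \<open>p\<close> to
    \<open>q\<close> alone.\<close>
  have redistribute: "M' \<in> reachable N"
    if "M \<in> reachable N" "M' \<in> markings P" "mrg M = mrg M'" "M q = 0" for M M'
  proof (rule redistribution_reachable[of "{p}" "{q}" M])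
    have "sum M A = sum M' A"
      using that by (simp add: merge_eq_iff)
    then show "M' r \<le> M r" if "r \<in> A - {q}" for r
      using that chain \<open>M q = 0\<close> by (cases "p = q") auto
  qed (use that chain move_reachable[OF c(1) carries pq] in auto)
  show ?thesis
  proof (rule reachable_of_merge_reachable[OF _ _ M])
    show "M \<in> reachable N" if "M \<in> markings P" "mrg M = mrg (init N)" for M
      using redistribute[OF reachable.init] that c by simp
  next
    fix t M
    assume t: "t \<in> transitions N" and M: "M \<in> markings P" "enabled N' t (mrg M)"
      and IH: "\<And>M'. M' \<in> markings P \<Longrightarrow> mrg M' = mrg M \<Longrightarrow> M' \<in> reachable N"
    show "\<exists>M0\<in>markings P. mrg M0 = mrg M \<and> enabled N t M0 \<and>
          (\<forall>M'\<in>markings P. mrg M' = mrg (fire N t M0) \<longrightarrow> M' \<in> reachable N)"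
    \<comment> \<open>The definition of a chain admits \<open>p = q\<close>, where \<open>A\<close>
      is a single place and there is nothing to distribute.\<close>
    proof (cases "t = c \<or> p = q")
      case True
      obtain M0 where M0: "M0 \<in> markings P" "mrg M0 = mrg M" "enabled N t M0"
        using enabled_redistribution t M by blast
      show ?thesis
      proof (cases "t = c")
        case True
        have "M0 p > 0"
          using M0 True c pq by (auto simp: enabled_def)
        \<comment> \<open>Firing \<open>c\<close> only moves a token within \<open>A\<close>, so
          \<open>IH\<close> already covers the result.\<close>
        then have "mrg (fire N t M0) = mrg M0"
          using fire_carries[OF carries M0(1)] pq True chain merge_move[of p q M0]
          by simp
        then show ?thesis
          using M0 IH by metis
      next
        case False
        with True have "p = q" by blast
        with chain(2) have A: "A = {p}" by blast
        have "fire N t M0 \<in> reachable N"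
          by (rule reachable.step[OF IH[OF M0(1,2)] t M0(3)])
        moreover have "M' \<in> reachable N"
          if "L \<in> reachable N" "M' \<in> markings P" "mrg L = mrg M'" for L M'
          using that by (intro redistribution_reachable[of "{p}" "{p}" L M']) (simp_all add: A)
        ultimately show ?thesis
          using M0 by (metis (no_types))
      qed
    next
      case False
      then have ne: "t \<noteq> c" "p \<noteq> q" by auto
      have "t \<notin> input_transitions N q"
        using c(6) ne(1) by simp
      then have post: "post N t q = 0"
        using t by (simp add: input_transitions_def)
      \<comment> \<open>\<open>q\<close> receives exactly what \<open>t\<close> takes from it and
        \<open>p\<close> all the rest. As \<open>t\<close> puts nothing into \<open>q\<close>,
        firing leaves \<open>q\<close> empty, as \<open>redistribute\<close> requires.\<close>
      define d where "d = (\<lambda>_. 0)(p := sum M A - pre N t q, q := pre N t q)"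
      have en: "\<forall>r\<in>P - A. pre N t r \<le> M r" "pre N t p + pre N t q \<le> sum M A"
        using M(2) ne(2) chain(2) unfolding enabled_replace_iff[OF t] by auto
      have d: "sum d A = sum M A"
        using en(2) ne(2) chain(2) by (simp add: d_def)
      let ?M0 = "override_on M d A"
      have M0: "?M0 \<in> markings P" "mrg ?M0 = mrg M"
        using override_markings[OF M(1)] merge_override[OF d] by auto
      have en0: "enabled N t ?M0"
        using en ne(2) chain(2) by (auto simp: enabled_def override_on_def d_def)
      have "fire N t ?M0 q = 0"
        using post pq chain(2) by (simp add: fire_def override_on_def d_def)
      moreover have "fire N t ?M0 \<in> reachable N"
        by (rule reachable.step[OF IH[OF M0] t en0])
      ultimately show ?thesis
        using redistribute M0 en0 by metis
    qed
  qed
qed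

end

theorem theorem3:
  fixes N :: "('p, 't) net" and A :: "'p set" and a :: 'p and m m' :: "'p \<Rightarrow> nat"
  assumes "petri_net N"
    and "A \<subseteq> places N"
    and "(\<exists>p q. chain_agglomerable N p q \<and> A = {p, q}) \<or>
         (\<exists>\<pi>. loop_agglomerable N \<pi> \<and> A = set \<pi>)"
    and "a \<notin> places N"
    and "m \<in> markings (places N - A)"
    and "m' \<in> markings A"
  shows "override_on m m' A \<in> reachable N \<longleftrightarrow>
         m(a := \<Sum>r\<in>A. m' r) \<in> reachable (replace_by_sum N A a)"
proof -
  interpret agglomeration N A a
    using assms by unfold_locales
  let ?M = "override_on m m' A"
  have M: "?M \<in> markings P"
    using assms(2,5) by (auto simp: markings_def override_on_def PiE_def extensional_def)
  \<comment> \<open>Equality of total functions: off \<open>P - A\<close> and \<open>a\<close>, both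
    sides are \<open>undefined\<close>.\<close>
  have "mrg ?M = m(a := \<Sum>r\<in>A. m' r)"
    using assms(5)
    by (auto simp: merge_def override_on_def fun_eq_iff markings_def PiE_def extensional_def)
  moreover have "?M \<in> reachable N \<longleftrightarrow> mrg ?M \<in> reachable N'"
    using merge_reachable loop_reachable chain_reachable M assms(3) by metis
  ultimately show ?thesis by simp
qed

end
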